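(* Let $N\ge2$ be an integer. Consider the sequence of Markov chains $X_{(d)}$ indexed by $d=1,2,\ldots$ on $\mathbb E_{(d)}=\{0,1,\ldots,N\}^d$ with initial distribution $\nu_{(d)}=\delta_{(0,\ldots,0)}$ and transition matrix $$\mathbf P_{(d)}(\mathbf i^{(1)},\mathbf i^{(2)})=\begin{cases} \dfrac{i^{(1)}_k+1}{i^{(1)}_k+2}\,p_k & \text{if } \mathbf i^{(2)}=\mathbf i^{(1)}+\mathbf s_k,\\[2mm] \left(\dfrac{\mathbf 1(i^{(1)}_k<N_k)}{(i^{(1)}_k+1)(i^{(1)}_k+2)}+\dfrac{\mathbf 1(i^{(1)}_k=N_k)}{N_k+1}\right)p_k & \text{if } \mathbf i^{(2)}=\mathbf i^{(1)}-m\,\mathbf s_k \text{ with } 1\le m\le i^{(1)}_k,\\[2mm] 1-\displaystyle\sum_{j:\,i^{(1)}_j<N_j}\left(1-\frac{1}{(i^{(1)}_j+1)(i^{(1)}_j+2)}\right)p_j-\sum_{j:\,i^{(1)}_j=N_j}\frac{N_j}{N_j+1}\,p_j & \text{if } \mathbf i^{(2)}=\mathbf i^{(1)} \end{cases}$$ (all other entries $0$), with $p_k=\frac1d$, $k=1,\ldots,d$, and $N_1=\ldots=N_d=N$. The stationary distribution $\pi_{(d)}$ is uniform. The sequence of chains exhibits a separation cutoff at time $d\log d+(N-1)d\log\log d$ with window size $d$.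
   Context: $\mathbf i^{(r)}=(i^{(r)}_1,\ldots,i^{(r)}_d)$; $\mathbf s_k=(0,\ldots,0,1,0,\ldots,0)$ with $1$ at position $k$. $N$ is fixed, independent of $d$. Separation: $sep(\mu,\pi)=\max_{\mathbf e}(1-\mu(\mathbf e)/\pi(\mathbf e))$. A sequence of ergodic chains $X_{(d)}\sim(\nu_{(d)},\mathbf P_{(d)})$ with stationary distributions $\pi_{(d)}$ exhibits a separation cutoff at time $t_d$ with window size $w_d=o(t_d)$ if $$\lim_{c\to\infty}\limsup_{d\to\infty}sep(\nu_{(d)}\mathbf P_{(d)}^{t_d+cw_d},\pi_{(d)})=0,\qquad \lim_{c\to\infty}\liminf_{d\to\infty}sep(\nu_{(d)}\mathbf P_{(d)}^{t_d-cw_d},\pi_{(d)})=1,$$ where non-integer exponents are replaced by their integer parts (floor), and only large $d$ matter (in particular $\log\log d$ is only needed for large $d$). *)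

theory Defs
  imports Complex_Main "HOL-Library.FuncSet" "HOL-Library.Landau_Symbols" "HOL-Library.Extended_Real"
begin

text \<open>
  A finite-state chain on a finite set \<open>S\<close> is given by an initial distribution and a transition
  matrix, both as real-valued functions of which only the values on \<open>S\<close> matter.
\<close>

definition distribution_on :: "'s set \<Rightarrow> ('s \<Rightarrow> real) \<Rightarrow> bool" where
  "distribution_on S \<mu> \<longleftrightarrow> (\<forall>x\<in>S. 0 \<le> \<mu> x) \<and> (\<Sum>x\<in>S. \<mu> x) = 1"

definition stochastic_on :: "'s set \<Rightarrow> ('s \<Rightarrow> 's \<Rightarrow> real) \<Rightarrow> bool" where
  "stochastic_on S P \<longleftrightarrow> (\<forall>x\<in>S. distribution_on S (P x))"

primrec matrix_power :: "'s set \<Rightarrow> ('s \<Rightarrow> 's \<Rightarrow> real) \<Rightarrow> nat \<Rightarrow> 's \<Rightarrow> 's \<Rightarrow> real" where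
  "matrix_power S P 0 x y = (if x = y then 1 else 0)"
| "matrix_power S P (Suc n) x y = (\<Sum>z\<in>S. matrix_power S P n x z * P z y)"

definition vec_matrix_mult :: "'s set \<Rightarrow> ('s \<Rightarrow> real) \<Rightarrow> ('s \<Rightarrow> 's \<Rightarrow> real) \<Rightarrow> 's \<Rightarrow> real" where
  "vec_matrix_mult S \<mu> P y = (\<Sum>x\<in>S. \<mu> x * P x y)"

definition irreducible_on :: "'s set \<Rightarrow> ('s \<Rightarrow> 's \<Rightarrow> real) \<Rightarrow> bool" where
  "irreducible_on S P \<longleftrightarrow> (\<forall>x\<in>S. \<forall>y\<in>S. \<exists>n. 0 < matrix_power S P n x y)"

definition aperiodic_on :: "'s set \<Rightarrow> ('s \<Rightarrow> 's \<Rightarrow> real) \<Rightarrow> bool" where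
  "aperiodic_on S P \<longleftrightarrow> (\<forall>x\<in>S. Gcd {n. 0 < n \<and> 0 < matrix_power S P n x x} = 1)"

definition ergodic_chain :: "'s set \<Rightarrow> ('s \<Rightarrow> real) \<Rightarrow> ('s \<Rightarrow> 's \<Rightarrow> real) \<Rightarrow> bool" where
  "ergodic_chain S \<nu> P \<longleftrightarrow>
     finite S \<and> S \<noteq> {} \<and> distribution_on S \<nu> \<and> stochastic_on S P \<and>
     irreducible_on S P \<and> aperiodic_on S P"

definition stationary_distribution :: "'s set \<Rightarrow> ('s \<Rightarrow> 's \<Rightarrow> real) \<Rightarrow> ('s \<Rightarrow> real) \<Rightarrow> bool" where
  "stationary_distribution S P \<pi> \<longleftrightarrow>
     distribution_on S \<pi> \<and> (\<forall>y\<in>S. vec_matrix_mult S \<pi> P y = \<pi> y)"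

definition separation :: "'s set \<Rightarrow> ('s \<Rightarrow> real) \<Rightarrow> ('s \<Rightarrow> real) \<Rightarrow> real" where
  "separation S \<mu> \<pi> = Max ((\<lambda>e. 1 - \<mu> e / \<pi> e) ` S)"

text \<open>
  Separation of the law at real time \<open>t\<close>, read as the integer part of \<open>t\<close>.  Negative times are
  clipped to \<open>0\<close>; below this concerns only finitely many \<open>d\<close> for each fixed \<open>c\<close> as soon as
  \<open>t d\<close> is eventually positive, because \<open>w \<in> o(t)\<close>.
\<close>

definition separation_at ::
    "'s set \<Rightarrow> ('s \<Rightarrow> real) \<Rightarrow> ('s \<Rightarrow> 's \<Rightarrow> real) \<Rightarrow> ('s \<Rightarrow> real) \<Rightarrow> real \<Rightarrow> real" where
  "separation_at S \<nu> P \<pi> t =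
     separation S (vec_matrix_mult S \<nu> (matrix_power S P (nat \<lfloor>t\<rfloor>))) \<pi>"

text \<open>
  The sequences are indexed by \<open>d = 1, 2, \<dots>\<close>.  The inner limits are taken in the extended reals,
  where they always exist.
\<close>

definition separation_cutoff ::
    "(nat \<Rightarrow> 's set) \<Rightarrow> (nat \<Rightarrow> 's \<Rightarrow> real) \<Rightarrow> (nat \<Rightarrow> 's \<Rightarrow> 's \<Rightarrow> real) \<Rightarrow> (nat \<Rightarrow> 's \<Rightarrow> real)
      \<Rightarrow> (nat \<Rightarrow> real) \<Rightarrow> (nat \<Rightarrow> real) \<Rightarrow> bool" where
  "separation_cutoff S \<nu> P \<pi> t w \<longleftrightarrow>
     (\<forall>d\<ge>1. ergodic_chain (S d) (\<nu> d) (P d) \<and> stationary_distribution (S d) (P d) (\<pi> d)) \<and>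
     w \<in> o(t) \<and>
     ((\<lambda>c::real. limsup (\<lambda>d. ereal (separation_at (S d) (\<nu> d) (P d) (\<pi> d) (t d + c * w d))))
        \<longlongrightarrow> 0) at_top \<and>
     ((\<lambda>c::real. liminf (\<lambda>d. ereal (separation_at (S d) (\<nu> d) (P d) (\<pi> d) (t d - c * w d))))
        \<longlongrightarrow> 1) at_top"

text \<open>
  A point of \<open>{0,\<dots>,N\<^sub>1} \<times> \<dots> \<times> {0,\<dots>,N\<^sub>d}\<close> is an extensional function on \<open>{1..d}\<close>; the upper ends
  \<open>N\<^sub>k\<close> are the values \<open>M k\<close>.
\<close>

definition grid :: "nat \<Rightarrow> (nat \<Rightarrow> nat) \<Rightarrow> (nat \<Rightarrow> nat) set" where
  "grid d M = (\<Pi>\<^sub>E k\<in>{1..d}. {0..M k})"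

definition origin :: "nat \<Rightarrow> nat \<Rightarrow> nat" where
  "origin d = (\<lambda>k\<in>{1..d}. 0)"

definition point_mass :: "'s \<Rightarrow> 's \<Rightarrow> real" where
  "point_mass a x = (if x = a then 1 else 0)"

text \<open>
  For \<open>y \<noteq> x\<close> there is at most one \<open>k\<close> with \<open>y = x + s\<^sub>k\<close>, or else at most one \<open>k\<close> with
  \<open>y = x - m s\<^sub>k\<close> for some \<open>m \<ge> 1\<close>, so each of the two sums in the second branch has at most one
  term, at most one of them is nonempty, and both are empty when \<open>y\<close> is not reachable in one step.
\<close>

definition transition_matrix ::
    "nat \<Rightarrow> (nat \<Rightarrow> nat) \<Rightarrow> (nat \<Rightarrow> real) \<Rightarrow> (nat \<Rightarrow> nat) \<Rightarrow> (nat \<Rightarrow> nat) \<Rightarrow> real" where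
  "transition_matrix d M p x y =
     (if y = x then
        1 - (\<Sum>j | j \<in> {1..d} \<and> x j < M j. (1 - 1 / ((real (x j) + 1) * (real (x j) + 2))) * p j)
          - (\<Sum>j | j \<in> {1..d} \<and> x j = M j. real (M j) / (real (M j) + 1) * p j)
      else
        (\<Sum>k | k \<in> {1..d} \<and> y = x(k := x k + 1). (real (x k) + 1) / (real (x k) + 2) * p k)
      + (\<Sum>k | k \<in> {1..d} \<and> (\<exists>m. 1 \<le> m \<and> m \<le> x k \<and> y = x(k := x k - m)).
           ((if x k < M k then 1 / ((real (x k) + 1) * (real (x k) + 2)) else 0)
          + (if x k = M k then 1 / (real (M k) + 1) else 0)) * p k))"

end

theory Submission
  imports Defs "HOL-Analysis.FPS_Convergence" "HOL-Real_Asymp.Real_Asymp"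
begin

unbundle no vec_syntax and fps_syntax

text \<open>
  Each step picks one of the \<open>d\<close> coordinates uniformly and moves it by a chain on \<open>{0..N}\<close>.  That
  one-coordinate chain maps the uniform law on \<open>{0..m}\<close> to the uniform law on \<open>{0..m + 1}\<close>, or to
  itself if \<open>m = N\<close> (\<open>uniform_upto_step\<close>).  So, given how often each coordinate was picked, the
  coordinates are independent and uniform on initial segments, and a coordinate is in equilibrium
  as soon as it was picked \<open>N\<close> times.  The density relative to the uniform law is smallest at the
  corner \<open>(N, \<dots>, N)\<close>, which has positive mass only if all coordinates are in equilibrium.
  Therefore the separation after \<open>n\<close> steps is exactly the probability that \<open>n\<close> uniform draws from
  \<open>d\<close> coupons do not yet contain \<open>N\<close> copies of each (\<open>separation_cube\<close>).  The cutoff is then the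
  Erdos-Renyi limit theorem for the coupon collector who wants \<open>N\<close> complete sets.

  The multinomial counts never appear explicitly.  The \<open>n\<close>-step law is \<open>n! / d ^ n\<close> times the
  \<open>n\<close>-th coefficient of a product of one-coordinate exponential generating functions
  (\<open>cube_power_origin\<close>), by the product rule for derivatives.  Comparing coefficients gives the
  separation, and shows that the probability \<open>collect_prob N d n\<close> of having collected everything
  increases with \<open>n\<close>.

  Evaluating the generating function instead of extracting coefficients is Poissonization: for a
  Poisson number of draws with mean \<open>l\<close>, the probability of having collected everything is
  \<open>(1 - q) ^ d\<close>, where \<open>q\<close> is the probability that a Poisson variable of mean \<open>l / d\<close> is below \<open>N\<close>.
  Monotonicity and Chernoff bounds sandwich \<open>collect_prob\<close> between two such values, with means one
  window \<open>d\<close> away (\<open>collect_prob_ge\<close>, \<open>collect_prob_le\<close>).  For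
  \<open>l = d ln d + (N - 1) d ln ln d + c d\<close> the expected number \<open>d q\<close> of deficient coupons tends to
  \<open>exp (- c) / (N - 1)!\<close> (\<open>tendsto_expected_deficient\<close>).  Since
  \<open>1 - d q \<le> (1 - q) ^ d \<le> exp (- d q)\<close>, letting \<open>c\<close> tend to infinity in either direction gives
  the two limits in the definition of the cutoff.
\<close>

section \<open>One coordinate\<close>

definition coord_step :: "nat \<Rightarrow> nat \<Rightarrow> nat \<Rightarrow> real" where
  "coord_step N i j =
     (if i < N
      then (if j \<le> i then 1 / ((real i + 1) * (real i + 2))
            else if j = Suc i then (real i + 1) / (real i + 2) else 0)
      else 1 / (real N + 1))"

definition uniform_upto :: "nat \<Rightarrow> nat \<Rightarrow> real" where
  "uniform_upto m j = (if j \<le> m then 1 / (real m + 1) else 0)"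

lemma coord_step_nonneg: "0 \<le> coord_step N i j"
  by (simp add: coord_step_def)

lemma coord_step_row_sum:
  assumes "i \<le> N"
  shows "(\<Sum>j\<le>N. coord_step N i j) = 1"
proof (cases "i < N")
  case True
  have "(\<Sum>j\<le>N. coord_step N i j) = (\<Sum>j\<le>Suc i. coord_step N i j)"
    using True by (intro sum.mono_neutral_right) (auto simp: coord_step_def)
  also have "\<dots> = (\<Sum>j\<le>i. 1 / ((real i + 1) * (real i + 2))) + (real i + 1) / (real i + 2)"
    using True by (simp add: coord_step_def)
  also have "\<dots> = 1"
    by (simp add: divide_simps) (simp add: algebra_simps)
  finally show ?thesis .
next
  case False
  then show ?thesis by (simp add: coord_step_def divide_simps)
qed

text \<open>
  Below a level \<open>m < N\<close> the chain only leaks upwards, to \<open>m + 1\<close>, and the probabilities are such that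
  the partial column sums agree on all columns up to \<open>m + 1\<close>; this is what keeps uniform laws uniform.
\<close>

lemma coord_step_partial_col_sum:
  assumes "m < N"
  shows "(\<Sum>i\<le>m. coord_step N i j) = (if j \<le> Suc m then (real m + 1) / (real m + 2) else 0)"
  using assms
proof (induction m)
  case 0
  then show ?case by (auto simp: coord_step_def)
next
  case (Suc m)
  have "(real m + 1) / (real m + 2) + 1 / ((real m + 2) * (real m + 3)) = (real m + 2) / (real m + 3)"
    by (simp add: divide_simps) (simp add: algebra_simps)
  with Suc show ?case by (auto simp: coord_step_def add.commute le_Suc_eq)
qed

lemma coord_step_col_sum:
  assumes "j \<le> N"
  shows "(\<Sum>i\<le>N. coord_step N i j) = 1"
proof (cases N)
  case 0
  then show ?thesis by (simp add: coord_step_def)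
next
  case (Suc M)
  have "(\<Sum>i\<le>N. coord_step N i j) = (\<Sum>i\<le>M. coord_step N i j) + coord_step N N j"
    by (simp add: Suc)
  also have "\<dots> = 1"
    using assms by (subst coord_step_partial_col_sum) (auto simp: coord_step_def Suc divide_simps algebra_simps)
  finally show ?thesis .
qed

text \<open>
  A coordinate started at \<open>0\<close> is uniform on an initial segment that grows by one point at each of
  its own moves (holding in place counts as a move), until it fills \<open>{0..N}\<close>.  So a coordinate
  that has moved \<open>n\<close> times has law \<open>uniform_upto (min n N)\<close>, which is the reason for the coupon collector in the background.
\<close>

lemma uniform_upto_step:
  assumes "m \<le> N" "j \<le> N"
  shows "(\<Sum>i\<le>N. uniform_upto m i * coord_step N i j) = uniform_upto (min (Suc m) N) j"
proof -
  have "(\<Sum>i\<le>N. uniform_upto m i * coord_step N i j) = (\<Sum>i\<le>m. uniform_upto m i * coord_step N i j)"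
    using assms by (intro sum.mono_neutral_right) (auto simp: uniform_upto_def)
  also have "\<dots> = (\<Sum>i\<le>m. coord_step N i j) / (real m + 1)"
    by (simp add: uniform_upto_def sum_divide_distrib)
  also have "\<dots> = uniform_upto (min (Suc m) N) j"
  proof (cases "m < N")
    case True
    then show ?thesis
      by (simp add: coord_step_partial_col_sum uniform_upto_def)
  next
    case False
    then have "m = N" using assms by simp
    then show ?thesis using assms
      by (simp add: coord_step_col_sum uniform_upto_def)
  qed
  finally show ?thesis .
qed

text \<open>
  The exponential generating function in \<open>n\<close> of the probability that a coordinate started at \<open>0\<close>
  is at \<open>j\<close> after \<open>n\<close> of its own moves.
\<close>

definition coord_fps :: "nat \<Rightarrow> nat \<Rightarrow> real fps" where
  "coord_fps N j = Abs_fps (\<lambda>n. uniform_upto (min n N) j / fact n)"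

lemma fps_deriv_coord_fps:
  assumes "j \<le> N"
  shows "fps_deriv (coord_fps N j) = (\<Sum>i\<le>N. fps_const (coord_step N i j) * coord_fps N i)"
proof (rule fps_ext)
  fix n
  have "fps_deriv (coord_fps N j) $ n = uniform_upto (min (Suc n) N) j / fact n"
    by (simp add: coord_fps_def del: of_nat_Suc)
  also have "min (Suc n) N = min (Suc (min n N)) N"
    by simp
  also have "uniform_upto \<dots> j = (\<Sum>i\<le>N. uniform_upto (min n N) i * coord_step N i j)"
    using assms by (simp add: uniform_upto_step)
  also have "\<dots> / fact n = (\<Sum>i\<le>N. fps_const (coord_step N i j) * coord_fps N i) $ n"
    by (simp add: coord_fps_def fps_sum_nth sum_divide_distrib mult.commute)
  finally show "fps_deriv (coord_fps N j) $ n = (\<Sum>i\<le>N. fps_const (coord_step N i j) * coord_fps N i) $ n" .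
qed

section \<open>Products of formal power series\<close>

lemma fps_deriv_prod:
  fixes f :: "'i \<Rightarrow> 'a::comm_ring_1 fps"
  assumes "finite A"
  shows "fps_deriv (\<Prod>k\<in>A. f k) = (\<Sum>k\<in>A. fps_deriv (f k) * (\<Prod>l\<in>A - {k}. f l))"
  using assms
proof (induction A)
  case empty
  then show ?case by simp
next
  case (insert a A)
  have "(\<Sum>k\<in>A. fps_deriv (f k) * (\<Prod>l\<in>insert a A - {k}. f l))
      = (\<Sum>k\<in>A. f a * (fps_deriv (f k) * (\<Prod>l\<in>A - {k}. f l)))"
  proof (rule sum.cong)
    fix k assume "k \<in> A"
    then have "insert a A - {k} = insert a (A - {k})" using insert by auto
    then show "fps_deriv (f k) * (\<Prod>l\<in>insert a A - {k}. f l)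
        = f a * (fps_deriv (f k) * (\<Prod>l\<in>A - {k}. f l))"
      using insert by (simp add: ac_simps)
  qed simp
  moreover have "insert a A - {a} = A" using insert by auto
  ultimately show ?case
    using insert by (simp add: sum_distrib_left algebra_simps)
qed

text \<open>
  Multiplication of series with nonnegative coefficients is monotone in every coefficient.  This
  one fact bounds the \<open>n\<close>-step law from below, and gives the bounds on \<open>collect_prob\<close>.
\<close>

lemma fps_prod_mono:
  fixes f g :: "'i \<Rightarrow> real fps"
  assumes "finite A" "\<And>k n. k \<in> A \<Longrightarrow> 0 \<le> f k $ n" "\<And>k n. k \<in> A \<Longrightarrow> f k $ n \<le> g k $ n"
  shows "0 \<le> (\<Prod>k\<in>A. f k) $ n \<and> (\<Prod>k\<in>A. f k) $ n \<le> (\<Prod>k\<in>A. g k) $ n"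
  using assms
proof (induction A arbitrary: n)
  case empty
  then show ?case by simp
next
  case (insert a A)
  have *: "0 \<le> (\<Prod>k\<in>A. f k) $ n" "(\<Prod>k\<in>A. f k) $ n \<le> (\<Prod>k\<in>A. g k) $ n" for n
    using insert by auto
  have "f a $ i * (\<Prod>k\<in>A. f k) $ j \<le> g a $ i * (\<Prod>k\<in>A. g k) $ j" for i j
    using insert.prems(1,2)[of a i] * by (intro mult_mono) auto
  then show ?case
    using insert.hyps insert.prems * by (auto simp: fps_mult_nth intro!: sum_nonneg sum_mono)
qed

lemma fps_prod_nth_0:
  fixes f :: "'i \<Rightarrow> 'a::comm_ring_1 fps"
  assumes "finite A"
  shows "(\<Prod>k\<in>A. f k) $ 0 = (\<Prod>k\<in>A. f k $ 0)"
  using assms by induction auto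

section \<open>The product chain\<close>

abbreviation cube :: "nat \<Rightarrow> nat \<Rightarrow> (nat \<Rightarrow> nat) set" where
  "cube N d \<equiv> grid d (\<lambda>k. N)"

abbreviation cube_step :: "nat \<Rightarrow> nat \<Rightarrow> (nat \<Rightarrow> nat) \<Rightarrow> (nat \<Rightarrow> nat) \<Rightarrow> real" where
  "cube_step N d \<equiv> transition_matrix d (\<lambda>k. N) (\<lambda>k. 1 / real d)"

lemma finite_cube: "finite (cube N d)"
  by (simp add: grid_def finite_PiE)

lemma card_cube: "card (cube N d) = Suc N ^ d"
  by (simp add: grid_def card_PiE)

lemma cube_le: "x \<in> cube N d \<Longrightarrow> k \<in> {1..d} \<Longrightarrow> x k \<le> N"
  by (auto simp: grid_def PiE_def Pi_def)

lemma cube_upd: "x \<in> cube N d \<Longrightarrow> k \<in> {1..d} \<Longrightarrow> i \<le> N \<Longrightarrow> x(k := i) \<in> cube N d"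
  by (auto simp: grid_def PiE_def Pi_def extensional_def)

lemma cube_eqI:
  assumes "x \<in> cube N d" "y \<in> cube N d" "\<And>k. k \<in> {1..d} \<Longrightarrow> x k = y k"
  shows "x = y"
  using assms unfolding grid_def by (meson PiE_ext)

lemma origin_in_cube: "origin d \<in> cube N d"
  by (auto simp: grid_def origin_def)

text \<open>
  The transition matrix is the average over the coordinates \<open>k\<close> of the matrices that move coordinate
  \<open>k\<close> by \<open>coord_step\<close> and freeze the others.  Off the diagonal at most one \<open>k\<close> contributes; on the
  diagonal the holding probabilities of all coordinates add up.
\<close>

lemma cube_step_eq:
  assumes "d \<ge> 1" "x \<in> cube N d" "y \<in> cube N d"
  shows "cube_step N d x y =
    (\<Sum>k\<in>{1..d}. if y = x(k := y k) then coord_step N (x k) (y k) else 0) / real d"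
proof (cases "y = x")
  case True
  let ?A = "{j \<in> {1..d}. x j < N}" and ?B = "{j \<in> {1..d}. x j = N}"
  have "x j < N \<or> x j = N" if "j \<in> {1..d}" for j
    using cube_le[OF assms(2) that] by auto
  then have AB: "?A \<union> ?B = {1..d}" "?A \<inter> ?B = {}"
    by blast+
  have split: "(\<Sum>j\<in>{1..d}. g j) = (\<Sum>j\<in>?A. g j) + (\<Sum>j\<in>?B. g j)" for g :: "nat \<Rightarrow> real"
    using sum.union_disjoint[of ?A ?B g] AB by simp
  have "(\<Sum>j\<in>?A. (1 - 1 / ((real (x j) + 1) * (real (x j) + 2))) * (1 / real d))
      = (\<Sum>j\<in>?A. (1 - coord_step N (x j) (x j)) / real d)"
    by (intro sum.cong) (auto simp: coord_step_def)
  moreover have "(\<Sum>j\<in>?B. real N / (real N + 1) * (1 / real d))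
      = (\<Sum>j\<in>?B. (1 - coord_step N (x j) (x j)) / real d)"
    by (intro sum.cong) (auto simp: coord_step_def divide_simps)
  ultimately have "cube_step N d x y = 1 - (\<Sum>j\<in>{1..d}. (1 - coord_step N (x j) (x j)) / real d)"
    using split[of "\<lambda>j. (1 - coord_step N (x j) (x j)) / real d"] True
    by (simp add: transition_matrix_def)
  also have "\<dots> = (\<Sum>k\<in>{1..d}. coord_step N (x k) (x k)) / real d"
    using assms(1) by (simp add: sum_subtractf diff_divide_distrib flip: sum_divide_distrib)
  finally show ?thesis using True by simp
next
  case False
  let ?up = "{k \<in> {1..d}. y = x(k := x k + 1)}"
  let ?down = "{k \<in> {1..d}. \<exists>m. 1 \<le> m \<and> m \<le> x k \<and> y = x(k := x k - m)}"
  have up: "(\<Sum>k\<in>?up. (real (x k) + 1) / (real (x k) + 2) * (1 / real d))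
    = (\<Sum>k\<in>{1..d}. if y = x(k := x k + 1) then coord_step N (x k) (y k) / real d else 0)"
  proof -
    have "x k < N" if "k \<in> {1..d}" "y = x(k := x k + 1)" for k
      using cube_le[OF assms(3) that(1)] that(2) by auto
    then show ?thesis
      by (subst sum.inter_filter[symmetric]) (auto intro!: sum.cong simp: coord_step_def)
  qed
  have down: "(\<Sum>k\<in>?down. ((if x k < N then 1 / ((real (x k) + 1) * (real (x k) + 2)) else 0)
          + (if x k = N then 1 / (real N + 1) else 0)) * (1 / real d))
    = (\<Sum>k\<in>{1..d}. if \<exists>m. 1 \<le> m \<and> m \<le> x k \<and> y = x(k := x k - m)
        then coord_step N (x k) (y k) / real d else 0)"
  proof -
    have "x k < N" if "k \<in> {1..d}" "x k \<noteq> N" for k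
      using cube_le[OF assms(2) that(1)] that(2) by simp
    then show ?thesis
      by (subst sum.inter_filter[symmetric]) (auto intro!: sum.cong simp: coord_step_def)
  qed
  have "cube_step N d x y =
     (\<Sum>k\<in>{1..d}. if y = x(k := x k + 1) then coord_step N (x k) (y k) / real d else 0)
   + (\<Sum>k\<in>{1..d}. if \<exists>m. 1 \<le> m \<and> m \<le> x k \<and> y = x(k := x k - m)
        then coord_step N (x k) (y k) / real d else 0)"
    unfolding transition_matrix_def up down using False by simp
  also have "\<dots> = (\<Sum>k\<in>{1..d}. if y = x(k := y k) then coord_step N (x k) (y k) / real d else 0)"
    unfolding sum.distrib[symmetric]
  proof (rule sum.cong)
    fix k assume k: "k \<in> {1..d}"
    have dn: "(\<exists>m. 1 \<le> m \<and> m \<le> x k \<and> y = x(k := x k - m)) \<longleftrightarrow> y = x(k := y k) \<and> y k < x k"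
    proof (intro iffI conjI)
      assume *: "y = x(k := y k) \<and> y k < x k"
      then show "\<exists>m. 1 \<le> m \<and> m \<le> x k \<and> y = x(k := x k - m)"
        by (intro exI[of _ "x k - y k"]) auto
    qed (auto simp: fun_eq_iff)
    have u: "y = x(k := x k + 1) \<longleftrightarrow> y = x(k := y k) \<and> y k = Suc (x k)"
      by (auto simp: fun_eq_iff)
    have ne: "y k \<noteq> x k" if "y = x(k := y k)"
      using False that by (metis fun_upd_triv)
    have 0: "coord_step N (x k) (y k) = 0" if "y k > Suc (x k)"
      using that cube_le[OF assms(3) k] by (simp add: coord_step_def)
    show "(if y = x(k := x k + 1) then coord_step N (x k) (y k) / real d else 0)
      + (if \<exists>m. 1 \<le> m \<and> m \<le> x k \<and> y = x(k := x k - m)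
        then coord_step N (x k) (y k) / real d else 0)
      = (if y = x(k := y k) then coord_step N (x k) (y k) / real d else 0)"
      unfolding dn u using ne 0 by (cases "y k" "Suc (x k)" rule: linorder_cases) auto
  qed simp
  finally show ?thesis
    by (auto simp: sum_divide_distrib intro!: sum.cong)
qed

lemma cube_step_nonneg:
  assumes "d \<ge> 1" "x \<in> cube N d" "y \<in> cube N d"
  shows "0 \<le> cube_step N d x y"
  unfolding cube_step_eq[OF assms] by (auto intro!: divide_nonneg_nonneg sum_nonneg coord_step_nonneg)

text \<open>
  The points that agree with \<open>e\<close> off coordinate \<open>k\<close> form a line parametrised by their \<open>k\<close>-th entry.
\<close>

lemma sum_cube_line:
  fixes a :: "(nat \<Rightarrow> nat) \<Rightarrow> real"
  assumes "e \<in> cube N d" "k \<in> {1..d}"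
  shows "(\<Sum>z\<in>cube N d. if e = z(k := e k) then a z else 0) = (\<Sum>i\<le>N. a (e(k := i)))"
proof -
  have "(\<Sum>z\<in>cube N d. if e = z(k := e k) then a z else 0) = sum a {z \<in> cube N d. e = z(k := e k)}"
    by (simp add: sum.inter_filter finite_cube)
  also have "{z \<in> cube N d. e = z(k := e k)} = (\<lambda>i. e(k := i)) ` {..N}"
  proof (intro equalityI subsetI)
    fix z assume z: "z \<in> {z \<in> cube N d. e = z(k := e k)}"
    then have "z = e(k := z k)" by (metis (mono_tags, lifting) fun_upd_triv fun_upd_upd mem_Collect_eq)
    moreover have "z k \<le> N" using z cube_le assms by blast
    ultimately show "z \<in> (\<lambda>i. e(k := i)) ` {..N}" by blast
  qed (use assms cube_upd in auto)
  also have "sum a \<dots> = (\<Sum>i\<le>N. a (e(k := i)))"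
    by (subst sum.reindex) (auto simp: inj_on_def dest: fun_upd_eqD)
  finally show ?thesis .
qed

lemma sum_cube_step_left:
  assumes "d \<ge> 1" "e \<in> cube N d"
  shows "(\<Sum>z\<in>cube N d. a z * cube_step N d z e) =
    (\<Sum>k\<in>{1..d}. \<Sum>i\<le>N. a (e(k := i)) * coord_step N i (e k)) / real d"
proof -
  have "(\<Sum>z\<in>cube N d. a z * cube_step N d z e) =
     (\<Sum>z\<in>cube N d. \<Sum>k\<in>{1..d}. if e = z(k := e k) then a z * coord_step N (z k) (e k) else 0) / real d"
    unfolding sum_divide_distrib using assms
    by (intro sum.cong refl)
       (auto simp: cube_step_eq sum_distrib_left sum_divide_distrib[symmetric] intro!: sum.cong)
  also have "\<dots> = (\<Sum>k\<in>{1..d}. \<Sum>z\<in>cube N d. if e = z(k := e k) then a z * coord_step N (z k) (e k) else 0) / real d"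
    by (subst sum.swap) simp
  also have "\<dots> = (\<Sum>k\<in>{1..d}. \<Sum>i\<le>N. a (e(k := i)) * coord_step N i (e k)) / real d"
    using sum_cube_line[OF assms(2), where a = "\<lambda>z. a z * coord_step N (z k) (e k)" and k = k for k]
    by simp
  finally show ?thesis .
qed

lemma sum_cube_step_row:
  assumes "d \<ge> 1" "x \<in> cube N d"
  shows "(\<Sum>y\<in>cube N d. cube_step N d x y) = 1"
proof -
  \<comment> \<open>The roles of the two points on a line are symmetric, so the line lemma also sums over targets.\<close>
  have sw: "y = x(k := y k) \<longleftrightarrow> x = y(k := x k)" for k y
    by (auto simp: fun_eq_iff)
  have "(\<Sum>y\<in>cube N d. cube_step N d x y) =
     (\<Sum>y\<in>cube N d. \<Sum>k\<in>{1..d}. if x = y(k := x k) then coord_step N (x k) (y k) else 0) / real d"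
    unfolding sum_divide_distrib using assms
    by (intro sum.cong refl) (simp add: cube_step_eq sw sum_divide_distrib)
  also have "\<dots> = (\<Sum>k\<in>{1..d}. \<Sum>y\<in>cube N d. if x = y(k := x k) then coord_step N (x k) (y k) else 0) / real d"
    by (subst sum.swap) simp
  also have "\<dots> = (\<Sum>k\<in>{1..d}. \<Sum>i\<le>N. coord_step N (x k) i) / real d"
    using sum_cube_line[OF assms(2), where a = "\<lambda>y. coord_step N (x k) (y k)" and k = k for k]
    by simp
  also have "\<dots> = 1"
    using assms(1) cube_le[OF assms(2)] by (simp add: coord_step_row_sum)
  finally show ?thesis .
qed

lemma sum_cube_step_col:
  assumes "d \<ge> 1" "e \<in> cube N d"
  shows "(\<Sum>z\<in>cube N d. cube_step N d z e) = 1"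
  using sum_cube_step_left[OF assms, of "\<lambda>_. 1"] cube_le[OF assms(2)] assms(1)
  by (simp add: coord_step_col_sum)

text \<open>
  Given that coordinate \<open>k\<close> was chosen \<open>n\<^sub>k\<close> times, the coordinates are independent, and the number
  of ways to choose them is the multinomial coefficient \<open>n! / (n\<^sub>1! \<cdots> n\<^sub>d!)\<close>: exactly the
  coefficient extraction from a product of exponential generating functions.  The induction over
  \<open>n\<close> replaces this bookkeeping by the product rule, since a shift of coefficients is a derivative
  and each factor obeys the forward equation \<open>fps_deriv_coord_fps\<close>.
\<close>

lemma cube_power_origin:
  assumes "d \<ge> 1" "e \<in> cube N d"
  shows "matrix_power (cube N d) (cube_step N d) n (origin d) e =
    fact n / real d ^ n * (\<Prod>k\<in>{1..d}. coord_fps N (e k)) $ n"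
  using assms(2)
proof (induction n arbitrary: e)
  case 0
  have "(\<Prod>k\<in>{1..d}. coord_fps N (e k) $ 0) = (\<Prod>k\<in>{1..d}. if e k = 0 then 1 else 0)"
    by (intro prod.cong) (auto simp: coord_fps_def uniform_upto_def)
  also have "\<dots> = (if \<forall>k\<in>{1..d}. e k = 0 then 1 else 0)"
    by (auto simp: prod_zero_iff)
  also have "(\<forall>k\<in>{1..d}. e k = 0) \<longleftrightarrow> origin d = e"
    using cube_eqI[OF origin_in_cube 0] by (auto simp: origin_def)
  finally show ?case by (simp add: fps_prod_nth_0)
next
  case (Suc n)
  let ?F = "\<lambda>e. \<Prod>k\<in>{1..d}. coord_fps N (e k)"
  have deriv: "fps_deriv (?F e) = (\<Sum>k\<in>{1..d}. \<Sum>i\<le>N. fps_const (coord_step N i (e k)) * ?F (e(k := i)))"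
  proof -
    have "coord_fps N i * (\<Prod>l\<in>{1..d} - {k}. coord_fps N (e l)) = ?F (e(k := i))"
      if "k \<in> {1..d}" for i k
    proof -
      have "?F (e(k := i)) = coord_fps N ((e(k := i)) k) * (\<Prod>l\<in>{1..d} - {k}. coord_fps N ((e(k := i)) l))"
        using that by (intro prod.remove) auto
      also have "(\<Prod>l\<in>{1..d} - {k}. coord_fps N ((e(k := i)) l)) = (\<Prod>l\<in>{1..d} - {k}. coord_fps N (e l))"
        by (intro prod.cong) auto
      finally show ?thesis by simp
    qed
    then have "fps_deriv (coord_fps N (e k)) * (\<Prod>l\<in>{1..d} - {k}. coord_fps N (e l))
      = (\<Sum>i\<le>N. fps_const (coord_step N i (e k)) * ?F (e(k := i)))" if "k \<in> {1..d}" for k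
      using that cube_le[OF Suc.prems that]
      by (simp add: fps_deriv_coord_fps sum_distrib_right mult.assoc)
    then show ?thesis
      by (simp add: fps_deriv_prod)
  qed
  have "matrix_power (cube N d) (cube_step N d) (Suc n) (origin d) e
      = (\<Sum>z\<in>cube N d. (fact n / real d ^ n * ?F z $ n) * cube_step N d z e)"
    by (simp add: Suc.IH)
  also have "\<dots> = (\<Sum>k\<in>{1..d}. \<Sum>i\<le>N. fact n / real d ^ n * ?F (e(k := i)) $ n * coord_step N i (e k)) / real d"
    by (rule sum_cube_step_left[OF assms(1) Suc.prems])
  also have "\<dots> = fact n / real d ^ n * fps_deriv (?F e) $ n / real d"
    unfolding deriv
    by (simp add: fps_sum_nth sum_distrib_left sum_divide_distrib mult_ac del: fun_upd_apply)
  also have "\<dots> = fact (Suc n) / real d ^ Suc n * ?F e $ Suc n"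
    by (simp add: field_simps)
  finally show ?case .
qed

section \<open>Ergodicity and the stationary distribution\<close>

lemma matrix_power_nonneg:
  assumes "\<And>x y. x \<in> S \<Longrightarrow> y \<in> S \<Longrightarrow> 0 \<le> P x y" "x \<in> S" "y \<in> S"
  shows "0 \<le> matrix_power S P n x y"
  using assms(2,3) by (induction n arbitrary: y) (auto intro!: sum_nonneg mult_nonneg_nonneg assms(1))

lemma matrix_power_step_pos:
  assumes "finite S" "\<And>x y. x \<in> S \<Longrightarrow> y \<in> S \<Longrightarrow> 0 \<le> P x y"
    and "x \<in> S" "y \<in> S" "z \<in> S" "0 < matrix_power S P n x z" "0 < P z y"
  shows "0 < matrix_power S P (Suc n) x y"
proof -
  have "0 < (\<Sum>z\<in>S. matrix_power S P n x z * P z y)"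
    using assms by (intro sum_pos2[of S z] mult_nonneg_nonneg matrix_power_nonneg) auto
  then show ?thesis by simp
qed

lemma invariant_vector_matrix_power:
  assumes "finite S" "\<And>y. y \<in> S \<Longrightarrow> vec_matrix_mult S v P y = v y" "y \<in> S"
  shows "(\<Sum>z\<in>S. v z * matrix_power S P n z y) = v y"
  using assms(3)
proof (induction n arbitrary: y)
  case 0
  then show ?case using assms(1) by (simp add: if_distrib cong: if_cong)
next
  case (Suc n)
  have "(\<Sum>z\<in>S. v z * matrix_power S P (Suc n) z y)
      = (\<Sum>w\<in>S. (\<Sum>z\<in>S. v z * matrix_power S P n z w) * P w y)"
    unfolding matrix_power.simps sum_distrib_left sum_distrib_right mult.assoc by (rule sum.swap)
  also have "\<dots> = v y"
    using Suc assms(2)[of y] by (simp add: vec_matrix_mult_def)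
  finally show ?case .
qed

text \<open>
  Where an invariant vector attains its maximum, it is an average of its values at all states, with
  positive weight on each given state once the number of steps is suitable; so all values equal the
  maximum.
\<close>

lemma doubly_stochastic_invariant_const:
  assumes "finite S" "irreducible_on S P"
    and "\<And>x y. x \<in> S \<Longrightarrow> y \<in> S \<Longrightarrow> 0 \<le> P x y"
    and "\<And>y. y \<in> S \<Longrightarrow> (\<Sum>x\<in>S. P x y) = 1"
    and "\<And>y. y \<in> S \<Longrightarrow> vec_matrix_mult S v P y = v y"
    and "x \<in> S" "y \<in> S"
  shows "v x = v y"
proof -
  have "Max (v ` S) \<in> v ` S"
    using assms(1,6) by (intro Max_in) auto
  then obtain a where "a \<in> S" "Max (v ` S) = v a"
    by blast
  then have a: "a \<in> S" "\<And>z. z \<in> S \<Longrightarrow> v z \<le> v a"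
    using assms(1) Max_ge[of "v ` S"] by auto
  have "v z = v a" if z: "z \<in> S" for z
  proof -
    obtain n where n: "0 < matrix_power S P n z a"
      using assms(2) z a(1) unfolding irreducible_on_def by blast
    have "(\<Sum>z\<in>S. 1 * matrix_power S P n z a) = 1"
      using assms(1,4) a by (intro invariant_vector_matrix_power) (auto simp: vec_matrix_mult_def)
    moreover have "(\<Sum>z\<in>S. v z * matrix_power S P n z a) = v a"
      using assms(1,5) a by (intro invariant_vector_matrix_power) auto
    ultimately have "(\<Sum>z\<in>S. (v a - v z) * matrix_power S P n z a) = 0"
      by (simp add: left_diff_distrib sum_subtractf flip: sum_distrib_left)
    moreover have "0 \<le> (v a - v z) * matrix_power S P n z a" if "z \<in> S" for z
      using that a assms(3) by (intro mult_nonneg_nonneg matrix_power_nonneg) auto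
    ultimately have "(v a - v z) * matrix_power S P n z a = 0"
      using assms(1) z by (simp add: sum_nonneg_eq_0_iff)
    with n show ?thesis by simp
  qed
  with assms(6,7) show ?thesis by simp
qed

lemma cube_step_pos:
  assumes "d \<ge> 1" "z \<in> cube N d" "k \<in> {1..d}" "i \<le> N" "i \<le> Suc (z k)"
  shows "0 < cube_step N d z (z(k := i))"
proof -
  have pos: "0 < coord_step N (z k) i"
    using assms(5) by (auto simp: coord_step_def le_Suc_eq)
  have "0 < (\<Sum>l\<in>{1..d}. if z(k := i) = z(l := (z(k := i)) l) then coord_step N (z l) ((z(k := i)) l) else 0)"
    using assms pos by (intro sum_pos2[of _ k]) (auto simp: coord_step_nonneg)
  then show ?thesis
    using assms cube_upd[OF assms(2-4)] by (simp add: cube_step_eq)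
qed

text \<open>
  One coordinate can drop to any lower level in one step and climb one level at a time, so
  coordinates can be set to their target values one after the other.
\<close>

lemma irreducible_cube:
  assumes d: "d \<ge> 1"
  shows "irreducible_on (cube N d) (cube_step N d)"
  unfolding irreducible_on_def
proof (intro ballI)
  fix x y assume x: "x \<in> cube N d" and y: "y \<in> cube N d"
  define reach where "reach = {z \<in> cube N d. \<exists>n. 0 < matrix_power (cube N d) (cube_step N d) n x z}"
  have step: "z(k := i) \<in> reach" if z_reach: "z \<in> reach" and ki: "k \<in> {1..d}" "i \<le> N" "i \<le> Suc (z k)" for z k i
  proof -
    obtain n where z: "z \<in> cube N d" "0 < matrix_power (cube N d) (cube_step N d) n x z"
      using z_reach by (auto simp: reach_def)
    have zi: "z(k := i) \<in> cube N d"
      using z(1) ki(1,2) by (rule cube_upd)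
    have "0 < matrix_power (cube N d) (cube_step N d) (Suc n) x (z(k := i))"
      using d z ki
      by (intro matrix_power_step_pos[OF finite_cube _ x zi z(1)] cube_step_nonneg cube_step_pos) auto
    with zi show ?thesis unfolding reach_def by blast
  qed
  have set_coord: "z(k := i) \<in> reach" if "z \<in> reach" "k \<in> {1..d}" "i \<le> N" for z k i
    using that(3)
  proof (induction i)
    case 0
    show ?case by (rule step[OF that(1,2)]) simp_all
  next
    case (Suc i)
    have "z(k := i) \<in> reach"
      by (rule Suc.IH) (use Suc.prems in simp)
    from step[OF this that(2) Suc.prems] show ?case
      by (simp only: fun_upd_upd fun_upd_same order_refl)
  qed
  have "(\<lambda>k. if k \<in> A then y k else x k) \<in> reach" if "finite A" "A \<subseteq> {1..d}" for A
    using that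
  proof (induction A)
    case empty
    have "0 < matrix_power (cube N d) (cube_step N d) 0 x x" by simp
    then have "\<exists>n. 0 < matrix_power (cube N d) (cube_step N d) n x x" by (rule exI)
    then show ?case using x by (simp add: reach_def)
  next
    case (insert a A)
    have "(\<lambda>k. if k \<in> insert a A then y k else x k) = (\<lambda>k. if k \<in> A then y k else x k)(a := y a)"
      by auto
    moreover have "(\<lambda>k. if k \<in> A then y k else x k)(a := y a) \<in> reach"
      using insert cube_le[OF y, of a] by (intro set_coord) auto
    ultimately show ?case by (simp only:)
  qed
  from this[of "{1..d}"] have "(\<lambda>k. if k \<in> {1..d} then y k else x k) \<in> reach" by simp
  moreover from this have "(\<lambda>k. if k \<in> {1..d} then y k else x k) = y"
    by (intro cube_eqI[of _ d N]) (auto simp: reach_def y)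
  ultimately show "\<exists>n. 0 < matrix_power (cube N d) (cube_step N d) n x y"
    by (simp add: reach_def)
qed

text \<open>
  Every coordinate holds its value with positive probability.
\<close>

lemma aperiodic_cube:
  assumes d: "d \<ge> 1"
  shows "aperiodic_on (cube N d) (cube_step N d)"
  unfolding aperiodic_on_def
proof
  fix x assume x: "x \<in> cube N d"
  have "0 < cube_step N d x (x(1 := x 1))"
    by (rule cube_step_pos[OF d x]) (use d cube_le[OF x, of 1] in simp_all)
  then have "0 < matrix_power (cube N d) (cube_step N d) (Suc 0) x x"
    using d by (intro matrix_power_step_pos[OF finite_cube _ x x x] cube_step_nonneg) auto
  then have "Gcd {n. 0 < n \<and> 0 < matrix_power (cube N d) (cube_step N d) n x x} dvd 1"
    by (intro Gcd_dvd) (simp del: matrix_power.simps)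
  then show "Gcd {n. 0 < n \<and> 0 < matrix_power (cube N d) (cube_step N d) n x x} = 1"
    by simp
qed

lemma card_cube_pos: "0 < card (cube N d)"
  by (simp add: card_cube)

lemma ergodic_cube:
  assumes d: "d \<ge> 1"
  shows "ergodic_chain (cube N d) (point_mass (origin d)) (cube_step N d)"
  unfolding ergodic_chain_def stochastic_on_def
proof (intro conjI ballI)
  show "cube N d \<noteq> {}"
    using origin_in_cube by blast
  show "distribution_on (cube N d) (point_mass (origin d))"
    by (simp add: distribution_on_def point_mass_def finite_cube origin_in_cube)
  show "distribution_on (cube N d) (cube_step N d x)" if "x \<in> cube N d" for x
    using that d by (simp add: distribution_on_def cube_step_nonneg sum_cube_step_row)
qed (use d in \<open>simp_all add: finite_cube irreducible_cube aperiodic_cube\<close>)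

lemma stationary_cube:
  assumes d: "d \<ge> 1"
  shows "stationary_distribution (cube N d) (cube_step N d) \<rho> \<longleftrightarrow>
    (\<forall>x\<in>cube N d. \<rho> x = 1 / real (card (cube N d)))"
proof
  assume st: "stationary_distribution (cube N d) (cube_step N d) \<rho>"
  have const: "\<rho> x = \<rho> y" if "x \<in> cube N d" "y \<in> cube N d" for x y
    by (rule doubly_stochastic_invariant_const[where v = \<rho> and x = x and y = y
          and S = "cube N d" and P = "cube_step N d"])
       (use st that d in \<open>auto simp: stationary_distribution_def finite_cube irreducible_cube
          cube_step_nonneg sum_cube_step_col\<close>)
  show "\<forall>x\<in>cube N d. \<rho> x = 1 / real (card (cube N d))"
  proof
    fix x assume x: "x \<in> cube N d"
    have "1 = (\<Sum>y\<in>cube N d. \<rho> y)"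
      using st by (simp add: stationary_distribution_def distribution_on_def)
    also have "\<dots> = (\<Sum>y\<in>cube N d. \<rho> x)"
      by (intro sum.cong refl const x)
    finally show "\<rho> x = 1 / real (card (cube N d))"
      using card_cube_pos[of d N] by (simp add: field_simps)
  qed
next
  assume *: "\<forall>x\<in>cube N d. \<rho> x = 1 / real (card (cube N d))"
  have "distribution_on (cube N d) \<rho>"
    using * card_cube_pos[of d N] by (simp add: distribution_on_def)
  moreover have "vec_matrix_mult (cube N d) \<rho> (cube_step N d) y = \<rho> y" if "y \<in> cube N d" for y
  proof -
    have "vec_matrix_mult (cube N d) \<rho> (cube_step N d) y
        = (\<Sum>x\<in>cube N d. cube_step N d x y / real (card (cube N d)))"
      unfolding vec_matrix_mult_def using * by (intro sum.cong) auto
    also have "\<dots> = \<rho> y"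
      using * that sum_cube_step_col[OF d that] by (simp flip: sum_divide_distrib)
    finally show ?thesis .
  qed
  ultimately show "stationary_distribution (cube N d) (cube_step N d) \<rho>"
    by (simp add: stationary_distribution_def)
qed

section \<open>Separation as a coupon-collector tail\<close>

definition coupon_fps :: "nat \<Rightarrow> real fps" where
  "coupon_fps N = Abs_fps (\<lambda>n. if n < N then 0 else 1 / fact n)"

text \<open>
  Expanding the power, this is \<open>1 / d ^ n\<close> times the number of words of length \<open>n\<close> over \<open>d\<close> letters
  in which every letter occurs at least \<open>N\<close> times: the probability that \<open>n\<close> uniform draws from \<open>d\<close>
  coupons yield at least \<open>N\<close> copies of each.
\<close>

definition collect_prob :: "nat \<Rightarrow> nat \<Rightarrow> nat \<Rightarrow> real" where
  "collect_prob N d n = fact n / real d ^ n * (coupon_fps N ^ d) $ n"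

text \<open>
  After \<open>m\<close> moves a coordinate has density \<open>(N + 1) / (m + 1) \<ge> 1\<close> relative to the uniform law on
  its first \<open>m + 1\<close> levels if \<open>m < N\<close>, and density \<open>1\<close> everywhere if \<open>m \<ge> N\<close>.  Hence the density
  at any point is at least the indicator of \<open>m \<ge> N\<close>, with equality at the top level \<open>N\<close>.
  Multiplying over the coordinates, the relative density of the whole chain is smallest at the
  corner \<open>(N, \<dots>, N)\<close>, where it is the probability that every coordinate has moved \<open>N\<close> times.
\<close>

lemma separation_cube:
  assumes d: "d \<ge> 1"
  shows "separation (cube N d)
      (vec_matrix_mult (cube N d) (point_mass (origin d)) (matrix_power (cube N d) (cube_step N d) n))
      (\<lambda>x. 1 / real (card (cube N d)))
    = 1 - collect_prob N d n"
proof -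
  let ?\<mu> = "vec_matrix_mult (cube N d) (point_mass (origin d)) (matrix_power (cube N d) (cube_step N d) n)"
  define g where "g = fps_const (1 / (real N + 1)) * coupon_fps N"
  have \<mu>: "?\<mu> e = fact n / real d ^ n * (\<Prod>k\<in>{1..d}. coord_fps N (e k)) $ n" if "e \<in> cube N d" for e
  proof -
    have "?\<mu> e = (\<Sum>x\<in>cube N d. if x = origin d then matrix_power (cube N d) (cube_step N d) n x e else 0)"
      unfolding vec_matrix_mult_def point_mass_def by (intro sum.cong) auto
    then show ?thesis
      using cube_power_origin[OF d that] finite_cube origin_in_cube by simp
  qed
  have g: "fact n / real d ^ n * (\<Prod>k\<in>{1..d}. g) $ n = collect_prob N d n / real (card (cube N d))"
    by (simp add: g_def power_mult_distrib card_cube collect_prob_def power_divide add.commute)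
  let ?top = "\<lambda>k\<in>{1..d}. N"
  have top: "?top \<in> cube N d" by (auto simp: grid_def)
  \<comment> \<open>At the top level the lower bound is attained coefficientwise.\<close>
  have "g = coord_fps N N"
    by (auto simp: g_def coord_fps_def coupon_fps_def uniform_upto_def fps_eq_iff)
  then have "(\<Prod>k\<in>{1..d}. coord_fps N (?top k)) = (\<Prod>k\<in>{1..d}. g)"
    by (intro prod.cong) auto
  then have \<mu>_top: "?\<mu> ?top = collect_prob N d n / real (card (cube N d))"
    using \<mu>[OF top] g by simp
  have \<mu>_ge: "collect_prob N d n / real (card (cube N d)) \<le> ?\<mu> e" if e: "e \<in> cube N d" for e
  proof -
    have "g $ m \<le> coord_fps N (e k) $ m" if "k \<in> {1..d}" for k m
      using cube_le[OF e that]
      by (auto simp: g_def coord_fps_def coupon_fps_def uniform_upto_def min_def divide_simps)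
    moreover have "0 \<le> g $ m" for m
      by (simp add: g_def coupon_fps_def)
    ultimately have "(\<Prod>k\<in>{1..d}. g) $ n \<le> (\<Prod>k\<in>{1..d}. coord_fps N (e k)) $ n"
      using fps_prod_mono[of "{1..d}" "\<lambda>_. g" "\<lambda>k. coord_fps N (e k)" n] by auto
    then show ?thesis
      unfolding g[symmetric] \<mu>[OF e] by (intro mult_left_mono) auto
  qed
  show ?thesis
    unfolding separation_def
  proof (rule Max_eqI)
    show "1 - collect_prob N d n \<in> (\<lambda>e. 1 - ?\<mu> e / (1 / real (card (cube N d)))) ` cube N d"
      using card_cube_pos[of d N] \<mu>_top by (intro image_eqI[OF _ top]) simp
  next
    fix v assume "v \<in> (\<lambda>e. 1 - ?\<mu> e / (1 / real (card (cube N d)))) ` cube N d"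
    then obtain e where e: "e \<in> cube N d" "v = 1 - ?\<mu> e * real (card (cube N d))" by auto
    then show "v \<le> 1 - collect_prob N d n"
      using \<mu>_ge[OF e(1)] card_cube_pos[of d N] by (simp add: field_simps)
  qed (simp add: finite_cube)
qed

lemma coupon_fps_nonneg: "0 \<le> coupon_fps N $ n"
  by (simp add: coupon_fps_def)

lemma coupon_fps_power_nonneg: "0 \<le> (coupon_fps N ^ d) $ n"
  using fps_prod_mono[of "{..<d}" "\<lambda>_. coupon_fps N" "\<lambda>_. coupon_fps N" n]
  by (simp add: coupon_fps_nonneg)

lemma collect_prob_nonneg: "0 \<le> collect_prob N d n"
  by (simp add: collect_prob_def coupon_fps_power_nonneg)

lemma collect_prob_le_1:
  assumes "d \<ge> 1"
  shows "collect_prob N d n \<le> 1"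
proof -
  have "(coupon_fps N ^ d) $ n \<le> (fps_exp 1 ^ d) $ n"
    using fps_prod_mono[of "{..<d}" "\<lambda>_. coupon_fps N" "\<lambda>_. fps_exp 1" n]
    by (simp add: coupon_fps_def)
  also have "\<dots> = real d ^ n / fact n"
    by (simp add: fps_exp_power_mult)
  finally show ?thesis
    using assms by (simp add: collect_prob_def field_simps)
qed

text \<open>
  The passage from \<open>n\<close> to \<open>n + 1\<close> draws is a derivative of \<open>coupon_fps N ^ d\<close>, and differentiating
  one factor \<open>coupon_fps N\<close> decreases none of its coefficients.
\<close>

lemma collect_prob_mono:
  assumes "d \<ge> 1" "m \<le> n"
  shows "collect_prob N d m \<le> collect_prob N d n"
proof -
  obtain d' where d': "d = Suc d'" using assms(1) by (cases d) auto
  have "collect_prob N d n \<le> collect_prob N d (Suc n)" for n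
  proof -
    have "coupon_fps N $ i \<le> fps_deriv (coupon_fps N) $ i" for i
      by (simp add: coupon_fps_def del: of_nat_Suc)
    then have "(coupon_fps N ^ d) $ n \<le> (fps_deriv (coupon_fps N) * coupon_fps N ^ d') $ n"
      by (auto simp: d' fps_mult_nth intro!: sum_mono mult_right_mono coupon_fps_power_nonneg)
    then have "real d * (coupon_fps N ^ d) $ n
        \<le> real d * (fps_deriv (coupon_fps N) * coupon_fps N ^ d') $ n"
      by (intro mult_left_mono) auto
    also have "\<dots> = fps_deriv (coupon_fps N ^ d) $ n"
      by (simp only: fps_deriv_power d' diff_Suc_1 mult.assoc flip: fps_mult_left_const_nth)
    also have "\<dots> = real (Suc n) * (coupon_fps N ^ d) $ Suc n"
      by simp
    finally show ?thesis
      using assms(1) by (simp add: collect_prob_def field_simps del: of_nat_Suc)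
  qed
  then show ?thesis using assms(2) by (rule lift_Suc_mono_le)
qed

section \<open>Poissonization\<close>

text \<open>
  The probability that a Poisson variable of mean \<open>s\<close> is below \<open>N\<close>.
\<close>

definition poisson_below :: "nat \<Rightarrow> real \<Rightarrow> real" where
  "poisson_below N s = exp (- s) * (\<Sum>j<N. s ^ j / fact j)"

lemma eval_coupon_fps:
  "fps_conv_radius (coupon_fps N) = \<infinity>"
  "eval_fps (coupon_fps N) s = exp s * (1 - poisson_below N s)"
proof -
  define p :: "real poly" where "p = (\<Sum>j<N. monom (1 / fact j) j)"
  have coupon: "coupon_fps N = fps_exp 1 - fps_of_poly p"
    by (auto simp: fps_eq_iff coupon_fps_def p_def coeff_sum)
  show "fps_conv_radius (coupon_fps N) = \<infinity>"
    using fps_conv_radius_diff[of "fps_exp 1" "fps_of_poly p"] by (simp add: coupon)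
  have "eval_fps (coupon_fps N) s = exp s - poly p s"
    unfolding coupon by (subst eval_fps_diff) auto
  also have "poly p s = (\<Sum>j<N. s ^ j / fact j)"
    by (simp add: p_def poly_sum poly_monom)
  finally show "eval_fps (coupon_fps N) s = exp s * (1 - poisson_below N s)"
    by (simp add: poisson_below_def algebra_simps flip: exp_add mult.assoc)
qed

text \<open>
  With a Poisson number of draws, of mean \<open>l\<close>, the numbers of copies of the \<open>d\<close> coupons are
  independent Poisson variables of mean \<open>l / d\<close>.  Analytically, this is the evaluation of a
  \<open>d\<close>-th power of a power series.
\<close>

lemma collect_prob_poissonized:
  assumes "d \<ge> 1"
  shows "(\<lambda>n. collect_prob N d n * (exp (- l) * l ^ n / fact n)) sums (1 - poisson_below N (l / real d)) ^ d"
proof -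
  have "fps_conv_radius (coupon_fps N ^ d) = \<infinity>"
    using fps_conv_radius_power[of "coupon_fps N" d] by (simp add: eval_coupon_fps)
  then have "(\<lambda>n. (coupon_fps N ^ d) $ n * (l / real d) ^ n) sums eval_fps (coupon_fps N ^ d) (l / real d)"
    by (intro sums_eval_fps) simp
  also have "eval_fps (coupon_fps N ^ d) (l / real d) = exp l * (1 - poisson_below N (l / real d)) ^ d"
    using assms by (simp add: eval_fps_power eval_coupon_fps power_mult_distrib flip: exp_of_nat_mult)
  finally have "(\<lambda>n. exp (- l) * ((coupon_fps N ^ d) $ n * (l / real d) ^ n)) sums
      (exp (- l) * (exp l * (1 - poisson_below N (l / real d)) ^ d))"
    by (rule sums_mult)
  moreover have "exp (- l) * ((coupon_fps N ^ d) $ n * (l / real d) ^ n)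
      = collect_prob N d n * (exp (- l) * l ^ n / fact n)" for n
    by (simp add: collect_prob_def power_divide)
  moreover have "exp (- l) * (exp l * r) = r" for r
    by (simp add: exp_minus)
  ultimately show ?thesis by (simp only:)
qed

text \<open>
  The exponential moments of the Poisson distribution of mean \<open>l\<close>; the case \<open>a = 0\<close> says that its
  weights add up to \<open>1\<close>.
\<close>

lemma poisson_exp_moment:
  "(\<lambda>n. exp (a * real n) * (exp (- l) * l ^ n / fact n)) sums exp (l * (exp a - 1))" for a l :: real
proof -
  have "(\<lambda>n. (l * exp a) ^ n / fact n) sums exp (l * exp a)"
    using exp_converges[of "l * exp a"] by (simp add: field_simps)
  from sums_mult[OF this, of "exp (- l)"]
  have "(\<lambda>n. exp (- l) * ((l * exp a) ^ n / fact n)) sums exp (l * (exp a - 1))"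
    by (simp add: algebra_simps flip: exp_add)
  moreover have "exp (- l) * ((l * exp a) ^ n / fact n) = exp (a * real n) * (exp (- l) * l ^ n / fact n)" for n
    by (simp add: power_mult_distrib mult.commute[of a] exp_of_nat_mult)
  ultimately show ?thesis by (simp only:)
qed

text \<open>
  A fixed number \<open>m\<close> of draws beats a Poisson number of smaller mean, up to the probability that the
  latter exceeds \<open>m\<close>, which Chernoff's bound controls: by monotonicity
  \<open>collect_prob N d n \<le> collect_prob N d m\<close> unless \<open>n > m\<close>, and then
  \<open>exp (\<theta> * (n - m)) \<ge> 1\<close>.  Averaging over \<open>n\<close> uses only the exponential moments.
\<close>

lemma collect_prob_ge:
  assumes d: "d \<ge> 1" and l: "l \<ge> 0" and \<theta>: "0 \<le> \<theta>" "\<theta> \<le> 1" and m: "l + D \<le> real m"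
  shows "(1 - poisson_below N (l / real d)) ^ d - exp (l * \<theta>\<^sup>2 - \<theta> * D) \<le> collect_prob N d m"
proof -
  let ?w = "\<lambda>n. exp (- l) * l ^ n / fact n"
  have "(1 - poisson_below N (l / real d)) ^ d
      \<le> collect_prob N d m * exp (l * (exp 0 - 1)) + exp (- \<theta> * real m) * exp (l * (exp \<theta> - 1))"
  proof (rule sums_le)
    show "(\<lambda>n. collect_prob N d n * ?w n) sums (1 - poisson_below N (l / real d)) ^ d"
      using d by (rule collect_prob_poissonized)
    show "(\<lambda>n. collect_prob N d m * (exp (0 * real n) * ?w n) + exp (- \<theta> * real m) * (exp (\<theta> * real n) * ?w n))
        sums (collect_prob N d m * exp (l * (exp 0 - 1)) + exp (- \<theta> * real m) * exp (l * (exp \<theta> - 1)))"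
      by (intro sums_add sums_mult poisson_exp_moment)
    fix n
    have "collect_prob N d n \<le> collect_prob N d m + exp (\<theta> * (real n - real m))"
    proof (cases "n \<le> m")
      case True
      then show ?thesis using collect_prob_mono[OF d True, of N] by (simp add: add_increasing2)
    next
      case False
      then have "1 \<le> exp (\<theta> * (real n - real m))" using \<theta> by simp
      then show ?thesis
        using collect_prob_le_1[OF d, of N n] collect_prob_nonneg[of N d m] by linarith
    qed
    then have "collect_prob N d n * ?w n \<le> (collect_prob N d m + exp (\<theta> * (real n - real m))) * ?w n"
      using l by (intro mult_right_mono) auto
    then show "collect_prob N d n * ?w n
      \<le> collect_prob N d m * (exp (0 * real n) * ?w n) + exp (- \<theta> * real m) * (exp (\<theta> * real n) * ?w n)"
      by (simp add: algebra_simps exp_diff exp_minus divide_simps)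
  qed
  also have "exp (- \<theta> * real m) * exp (l * (exp \<theta> - 1)) = exp (l * (exp \<theta> - 1) - \<theta> * real m)"
    by (simp flip: exp_add)
  also have "\<dots> \<le> exp (l * \<theta>\<^sup>2 - \<theta> * D)"
  proof -
    \<comment> \<open>The bound \<open>exp \<theta> \<le> 1 + \<theta> + \<theta>\<^sup>2\<close> makes the first-order terms cancel.\<close>
    have "l * (exp \<theta> - 1) \<le> l * (\<theta> + \<theta>\<^sup>2)"
      using l exp_bound[OF \<theta>] by (intro mult_left_mono) auto
    moreover have "\<theta> * (l + D) \<le> \<theta> * real m"
      using m \<theta> by (intro mult_left_mono) auto
    ultimately show ?thesis by (simp add: algebra_simps)
  qed
  finally show ?thesis by simp
qed

text \<open>
  The mirror image: a fixed number \<open>m\<close> of draws loses against a Poisson number of larger mean,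
  except when the latter falls below \<open>m\<close>.
\<close>

lemma collect_prob_le:
  assumes d: "d \<ge> 1" and l: "l \<ge> 0" and \<theta>: "0 \<le> \<theta>" "\<theta> \<le> 1" and m: "real m \<le> l - D"
  shows "collect_prob N d m \<le> (1 - poisson_below N (l / real d)) ^ d + exp (l * \<theta>\<^sup>2 - \<theta> * D)"
proof -
  let ?w = "\<lambda>n. exp (- l) * l ^ n / fact n"
  have "collect_prob N d m * exp (l * (exp 0 - 1))
      \<le> (1 - poisson_below N (l / real d)) ^ d + exp (\<theta> * real m) * exp (l * (exp (- \<theta>) - 1))"
  proof (rule sums_le)
    show "(\<lambda>n. collect_prob N d m * (exp (0 * real n) * ?w n)) sums (collect_prob N d m * exp (l * (exp 0 - 1)))"
      by (intro sums_mult poisson_exp_moment)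
    show "(\<lambda>n. collect_prob N d n * ?w n + exp (\<theta> * real m) * (exp (- \<theta> * real n) * ?w n))
        sums ((1 - poisson_below N (l / real d)) ^ d + exp (\<theta> * real m) * exp (l * (exp (- \<theta>) - 1)))"
      by (intro sums_add sums_mult poisson_exp_moment collect_prob_poissonized d)
    fix n
    have "collect_prob N d m \<le> collect_prob N d n + exp (\<theta> * (real m - real n))"
    proof (cases "m \<le> n")
      case True
      then show ?thesis using collect_prob_mono[OF d True, of N] by (simp add: add_increasing2)
    next
      case False
      then have "1 \<le> exp (\<theta> * (real m - real n))" using \<theta> by simp
      then show ?thesis
        using collect_prob_le_1[OF d, of N m] collect_prob_nonneg[of N d n] by linarith
    qed
    then have "collect_prob N d m * ?w n \<le> (collect_prob N d n + exp (\<theta> * (real m - real n))) * ?w n"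
      using l by (intro mult_right_mono) auto
    then show "collect_prob N d m * (exp (0 * real n) * ?w n)
      \<le> collect_prob N d n * ?w n + exp (\<theta> * real m) * (exp (- \<theta> * real n) * ?w n)"
      by (simp add: algebra_simps exp_diff exp_minus divide_simps)
  qed
  also have "exp (\<theta> * real m) * exp (l * (exp (- \<theta>) - 1)) = exp (l * (exp (- \<theta>) - 1) + \<theta> * real m)"
    by (simp add: add.commute flip: exp_add)
  also have "\<dots> \<le> exp (l * \<theta>\<^sup>2 - \<theta> * D)"
  proof -
    \<comment> \<open>The product is \<open>1 + \<theta>\<^sup>3\<close>; this bounds \<open>exp (- \<theta>)\<close> to second order through \<open>exp \<theta> \<ge> 1 + \<theta>\<close>.\<close>
    have "1 \<le> (1 + \<theta>) * (1 - \<theta> + \<theta>\<^sup>2)"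
      using \<theta> by (simp add: algebra_simps power2_eq_square)
    also have "\<dots> \<le> exp \<theta> * (1 - \<theta> + \<theta>\<^sup>2)"
      using \<theta> exp_ge_add_one_self[of \<theta>] by (intro mult_right_mono) auto
    finally have "exp (- \<theta>) \<le> 1 - \<theta> + \<theta>\<^sup>2"
      by (simp add: exp_minus field_simps)
    then have "l * (exp (- \<theta>) - 1) \<le> l * (\<theta>\<^sup>2 - \<theta>)"
      using l by (intro mult_left_mono) auto
    moreover have "\<theta> * real m \<le> \<theta> * (l - D)"
      using m \<theta> by (intro mult_left_mono) auto
    ultimately show ?thesis by (simp add: algebra_simps)
  qed
  finally show ?thesis by simp
qed

section \<open>Asymptotics\<close>

text \<open>
  The mean number of moves of a coordinate up to time \<open>t\<^sub>d + c d\<close>.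
\<close>

definition cutoff_scale :: "nat \<Rightarrow> real \<Rightarrow> nat \<Rightarrow> real" where
  "cutoff_scale N c d = ln (real d) + (real N - 1) * ln (ln (real d)) + c"

text \<open>
  The expected number of coordinates with fewer than \<open>N\<close> moves stays of order one.  Since
  \<open>exp (- s) = exp (- c) / (d * ln d ^ (N - 1))\<close> and \<open>s \<sim> ln d\<close>, only the summand
  \<open>j = N - 1\<close> of \<open>poisson_below\<close> survives, which explains the \<open>N - 1\<close> in the cutoff time.
\<close>

lemma tendsto_expected_deficient:
  assumes "N \<ge> 1"
  shows "(\<lambda>d. real d * poisson_below N (cutoff_scale N c d)) \<longlonglongrightarrow> exp (- c) / fact (N - 1)"
proof -
  obtain M where N: "N = Suc M" using assms by (cases N) auto
  let ?s = "cutoff_scale N c"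
  have ratio: "(\<lambda>d. ?s d / ln (real d)) \<longlonglongrightarrow> 1"
    unfolding cutoff_scale_def by real_asymp
  have inv: "(\<lambda>d::nat. 1 / ln (real d)) \<longlonglongrightarrow> 0"
    by real_asymp
  have lim: "(\<lambda>d. exp (- c) * (\<Sum>j<N. (?s d / ln (real d)) ^ j * (1 / ln (real d)) ^ (M - j) / fact j))
      \<longlonglongrightarrow> exp (- c) * (\<Sum>j<N. 1 ^ j * 0 ^ (M - j) / fact j)"
    by (intro tendsto_intros ratio inv) auto
  have sum: "(\<Sum>j<N. 1 ^ j * 0 ^ (M - j) / fact j) = (1 / fact M :: real)"
    by (simp add: N power_0_left)
  have "eventually (\<lambda>d. exp (- c) * (\<Sum>j<N. (?s d / ln (real d)) ^ j * (1 / ln (real d)) ^ (M - j) / fact j)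
      = real d * poisson_below N (?s d)) sequentially"
    using eventually_ge_at_top[of 3]
  proof eventually_elim
    case (elim d)
    have L: "0 < ln (real d)" using elim by simp
    have "exp (- ?s d) = exp (- c) * (exp (- ln (real d)) * exp (- (real M * ln (ln (real d)))))"
      by (simp add: cutoff_scale_def N flip: exp_add)
    also have "\<dots> = exp (- c) / (real d * ln (real d) ^ M)"
      using elim L by (simp add: exp_minus exp_of_nat_mult field_simps)
    finally have e: "real d * exp (- ?s d) = exp (- c) / ln (real d) ^ M"
      using elim by simp
    have "(?s d / ln (real d)) ^ j * (1 / ln (real d)) ^ (M - j) / fact j
        = (?s d ^ j / fact j) / ln (real d) ^ M" if "j < N" for j
    proof -
      have "ln (real d) ^ M = ln (real d) ^ j * ln (real d) ^ (M - j)"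
        using that by (simp add: N flip: power_add)
      then show ?thesis by (simp add: power_divide)
    qed
    then have "(\<Sum>j<N. (?s d / ln (real d)) ^ j * (1 / ln (real d)) ^ (M - j) / fact j)
        = (\<Sum>j<N. ?s d ^ j / fact j) / ln (real d) ^ M"
      by (simp add: sum_divide_distrib)
    then show ?case
      unfolding poisson_below_def by (simp add: e mult.assoc[symmetric])
  qed
  from Lim_transform_eventually[OF lim this] show ?thesis
    unfolding sum by (simp add: N)
qed

lemma poisson_below_le_1:
  assumes "0 \<le> s"
  shows "poisson_below N s \<le> 1"
proof -
  have "(\<lambda>j. s ^ j / fact j) sums exp s"
    using exp_converges[of s] by (simp add: field_simps)
  then have "(\<Sum>j<N. s ^ j / fact j) \<le> exp s"
    using assms sum_le_suminf[of "\<lambda>j. s ^ j / fact j" "{..<N}"] by (auto simp: sums_iff)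
  then show ?thesis
    by (simp add: poisson_below_def exp_minus field_simps)
qed

lemma eventually_cutoff_scale_nonneg: "eventually (\<lambda>d. 0 \<le> cutoff_scale N c d) sequentially"
  unfolding cutoff_scale_def by real_asymp

text \<open>
  The Chernoff error at distance \<open>D = d\<close> from the mean \<open>l = d * s\<close>, for the choice
  \<open>\<theta> = 1 / sqrt d\<close>.  Fluctuations of a Poisson variable of mean about \<open>d ln d\<close> are far smaller than
  the window \<open>d\<close>, so Poissonization does not affect the cutoff.
\<close>

lemma chernoff_error_tendsto_0: "(\<lambda>d. exp (cutoff_scale N c d - sqrt (real d))) \<longlonglongrightarrow> 0"
  unfolding cutoff_scale_def by real_asymp

lemma chernoff_exponent:
  assumes "d \<ge> 1"
  shows "real d * s * (1 / sqrt (real d))\<^sup>2 - 1 / sqrt (real d) * real d = s - sqrt (real d)"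
  using assms by (simp add: power_divide real_div_sqrt)

text \<open>
  The Poisson mean is taken two windows below the given time: one for the Chernoff bound and one to
  absorb the rounding of the time.  The union bound enters as Bernoulli's inequality.
\<close>

lemma limsup_not_collected_le:
  assumes "N \<ge> 1"
  shows "limsup (\<lambda>d. ereal (1 - collect_prob N d (nat \<lfloor>real d * cutoff_scale N c d\<rfloor>)))
    \<le> ereal (exp (2 - c) / fact (N - 1))"
proof -
  let ?s = "cutoff_scale N (c - 2)"
  let ?u = "\<lambda>d. real d * poisson_below N (?s d) + exp (?s d - sqrt (real d))"
  have "?u \<longlonglongrightarrow> exp (- (c - 2)) / fact (N - 1) + 0"
    by (intro tendsto_add tendsto_expected_deficient chernoff_error_tendsto_0 assms)
  then have lim: "limsup (\<lambda>d. ereal (?u d)) = ereal (exp (2 - c) / fact (N - 1))"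
    by (intro lim_imp_Limsup) auto
  have "eventually (\<lambda>d. ereal (1 - collect_prob N d (nat \<lfloor>real d * cutoff_scale N c d\<rfloor>)) \<le> ereal (?u d)) sequentially"
    using eventually_ge_at_top[of 1] eventually_cutoff_scale_nonneg[of N "c - 2"]
  proof eventually_elim
    case (elim d)
    let ?l = "real d * ?s d" and ?m = "nat \<lfloor>real d * cutoff_scale N c d\<rfloor>"
    have scale: "real d * cutoff_scale N c d = ?l + 2 * real d"
      by (simp add: cutoff_scale_def algebra_simps)
    have m: "?l + real d \<le> real ?m"
      using elim scale by linarith
    have "(1 - poisson_below N (?l / real d)) ^ d
        - exp (?l * (1 / sqrt (real d))\<^sup>2 - 1 / sqrt (real d) * real d) \<le> collect_prob N d ?m"
      using elim m by (intro collect_prob_ge) auto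
    moreover have "?l / real d = ?s d"
      using elim by simp
    ultimately have "(1 - poisson_below N (?s d)) ^ d - exp (?s d - sqrt (real d)) \<le> collect_prob N d ?m"
      using elim chernoff_exponent[of d "?s d"] by simp
    moreover have "1 + real d * (- poisson_below N (?s d)) \<le> (1 + (- poisson_below N (?s d))) ^ d"
      using poisson_below_le_1[OF elim(2), of N] by (intro Bernoulli_inequality) simp
    ultimately show ?case by simp
  qed
  from Limsup_mono[OF this] show ?thesis
    unfolding lim .
qed

text \<open>
  The Poisson mean is taken one window above the given time; rounding down goes in the right
  direction here.  Independence gives \<open>(1 - q) ^ d \<le> exp (- d q)\<close>.
\<close>

lemma liminf_not_collected_ge:
  assumes "N \<ge> 1"
  shows "ereal (1 - exp (- (exp (- c - 1) / fact (N - 1))))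
    \<le> liminf (\<lambda>d. ereal (1 - collect_prob N d (nat \<lfloor>real d * cutoff_scale N c d\<rfloor>)))"
proof -
  let ?s = "cutoff_scale N (c + 1)"
  let ?u = "\<lambda>d. 1 - exp (- (real d * poisson_below N (?s d))) - exp (?s d - sqrt (real d))"
  have "?u \<longlonglongrightarrow> 1 - exp (- (exp (- (c + 1)) / fact (N - 1))) - 0"
    by (intro tendsto_intros tendsto_expected_deficient chernoff_error_tendsto_0 assms)
  then have lim: "liminf (\<lambda>d. ereal (?u d)) = ereal (1 - exp (- (exp (- c - 1) / fact (N - 1))))"
    by (intro lim_imp_Liminf) auto
  have "eventually (\<lambda>d. ereal (?u d) \<le> ereal (1 - collect_prob N d (nat \<lfloor>real d * cutoff_scale N c d\<rfloor>))) sequentially"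
    using eventually_ge_at_top[of 1] eventually_cutoff_scale_nonneg[of N c] eventually_cutoff_scale_nonneg[of N "c + 1"]
  proof eventually_elim
    case (elim d)
    let ?l = "real d * ?s d" and ?m = "nat \<lfloor>real d * cutoff_scale N c d\<rfloor>"
    have scale: "real d * cutoff_scale N c d = ?l - real d"
      by (simp add: cutoff_scale_def algebra_simps)
    have "0 \<le> real d * cutoff_scale N c d"
      using elim by simp
    then have m: "real ?m \<le> ?l - real d"
      using scale by linarith
    have "collect_prob N d ?m \<le> (1 - poisson_below N (?l / real d)) ^ d
        + exp (?l * (1 / sqrt (real d))\<^sup>2 - 1 / sqrt (real d) * real d)"
      using elim m by (intro collect_prob_le) auto
    moreover have "?l / real d = ?s d"
      using elim by simp
    ultimately have "collect_prob N d ?m \<le> (1 - poisson_below N (?s d)) ^ d + exp (?s d - sqrt (real d))"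
      using elim chernoff_exponent[of d "?s d"] by simp
    also have "(1 - poisson_below N (?s d)) ^ d \<le> exp (- poisson_below N (?s d)) ^ d"
      using poisson_below_le_1[OF elim(3), of N] exp_ge_add_one_self[of "- poisson_below N (?s d)"]
      by (intro power_mono) auto
    also have "\<dots> = exp (- (real d * poisson_below N (?s d)))"
      by (simp flip: exp_of_nat_mult)
    finally show ?case by simp
  qed
  from Liminf_mono[OF this] show ?thesis
    unfolding lim .
qed

theorem corollary4p14:
  fixes N :: nat
    and E :: "nat \<Rightarrow> (nat \<Rightarrow> nat) set"
    and \<nu> \<pi> :: "nat \<Rightarrow> (nat \<Rightarrow> nat) \<Rightarrow> real"
    and P :: "nat \<Rightarrow> (nat \<Rightarrow> nat) \<Rightarrow> (nat \<Rightarrow> nat) \<Rightarrow> real"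
  assumes "N \<ge> 2"
    and "\<And>d. E d = grid d (\<lambda>k. N)"
    and "\<And>d. \<nu> d = point_mass (origin d)"
    and "\<And>d. P d = transition_matrix d (\<lambda>k. N) (\<lambda>k. 1 / real d)"
    and "\<And>d. \<pi> d = (\<lambda>x. 1 / real (card (E d)))"
  shows "(\<forall>d\<ge>1. \<forall>\<rho>. stationary_distribution (E d) (P d) \<rho> \<longleftrightarrow> (\<forall>x\<in>E d. \<rho> x = \<pi> d x)) \<and>
    separation_cutoff E \<nu> P \<pi>
      (\<lambda>d. real d * ln (real d) + (real N - 1) * real d * ln (ln (real d)))
      (\<lambda>d. real d)"
proof -
  let ?t = "\<lambda>d. real d * ln (real d) + (real N - 1) * real d * ln (ln (real d))"
  let ?sep = "\<lambda>d t. separation_at (E d) (\<nu> d) (P d) (\<pi> d) t"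
  let ?g = "\<lambda>c d. 1 - collect_prob N d (nat \<lfloor>real d * cutoff_scale N c d\<rfloor>)"
  have N: "N \<ge> 1" using assms(1) by simp
  have stationary: "\<forall>d\<ge>1. \<forall>\<rho>. stationary_distribution (E d) (P d) \<rho> \<longleftrightarrow> (\<forall>x\<in>E d. \<rho> x = \<pi> d x)"
    unfolding assms(2-5) using stationary_cube by blast
  have ergodic: "\<forall>d\<ge>1. ergodic_chain (E d) (\<nu> d) (P d)"
    unfolding assms(2-5) using ergodic_cube by blast
  have sep: "eventually (\<lambda>d. ereal (?sep d (?t d + c * real d)) = ereal (?g c d)) sequentially" for c
    using eventually_ge_at_top[of 1]
  proof eventually_elim
    case (elim d)
    have "?t d + c * real d = real d * cutoff_scale N c d"
      by (simp add: cutoff_scale_def algebra_simps)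
    then show ?case
      unfolding separation_at_def assms(2-5) by (simp only: separation_cube[OF elim])
  qed
  have g_bounds: "eventually (\<lambda>d. 0 \<le> ?g c d \<and> ?g c d \<le> 1) sequentially" for c
    using eventually_ge_at_top[of 1]
    by eventually_elim (simp add: collect_prob_nonneg collect_prob_le_1)
  have "((\<lambda>c. limsup (\<lambda>d. ereal (?sep d (?t d + c * real d)))) \<longlongrightarrow> 0) at_top"
  proof (rule tendsto_sandwich[where f = "\<lambda>_. 0" and h = "\<lambda>c. ereal (exp (2 - c) / fact (N - 1))"])
    have "((\<lambda>c::real. exp (2 - c) / fact (N - 1)) \<longlongrightarrow> 0) at_top"
      by real_asymp
    then show "((\<lambda>c. ereal (exp (2 - c) / fact (N - 1))) \<longlongrightarrow> 0) at_top"
      by (simp add: zero_ereal_def)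
    show "eventually (\<lambda>c. limsup (\<lambda>d. ereal (?sep d (?t d + c * real d)))
        \<le> ereal (exp (2 - c) / fact (N - 1))) at_top"
      using limsup_not_collected_le[OF N] by (simp add: Limsup_eq[OF sep])
    show "eventually (\<lambda>c. 0 \<le> limsup (\<lambda>d. ereal (?sep d (?t d + c * real d)))) at_top"
    proof (intro always_eventually allI)
      fix c
      have "(0::ereal) = limsup (\<lambda>d. 0)"
        by (simp add: Limsup_const)
      also have "\<dots> \<le> limsup (\<lambda>d. ereal (?g c d))"
        by (intro Limsup_mono eventually_mono[OF g_bounds[of c]]) simp
      finally show "0 \<le> limsup (\<lambda>d. ereal (?sep d (?t d + c * real d)))"
        by (simp add: Limsup_eq[OF sep])
    qed
  qed simp
  moreover have "((\<lambda>c. liminf (\<lambda>d. ereal (?sep d (?t d - c * real d)))) \<longlongrightarrow> 1) at_top"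
  proof (rule tendsto_sandwich[where h = "\<lambda>_. 1" and f = "\<lambda>c. ereal (1 - exp (- (exp (c - 1) / fact (N - 1))))"])
    have "((\<lambda>c::real. 1 - exp (- (exp (c - 1) / fact (N - 1)))) \<longlongrightarrow> 1) at_top"
      by real_asymp
    then show "((\<lambda>c. ereal (1 - exp (- (exp (c - 1) / fact (N - 1))))) \<longlongrightarrow> 1) at_top"
      by (simp add: one_ereal_def)
    have sep': "liminf (\<lambda>d. ereal (?sep d (?t d - c * real d))) = liminf (\<lambda>d. ereal (?g (- c) d))" for c
      using Liminf_eq[OF sep[of "- c"]] by simp
    show "eventually (\<lambda>c. ereal (1 - exp (- (exp (c - 1) / fact (N - 1))))
        \<le> liminf (\<lambda>d. ereal (?sep d (?t d - c * real d)))) at_top"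
      unfolding sep' using liminf_not_collected_ge[OF N, of "- c" for c] by simp
    show "eventually (\<lambda>c. liminf (\<lambda>d. ereal (?sep d (?t d - c * real d))) \<le> 1) at_top"
    proof (intro always_eventually allI)
      fix c
      show "liminf (\<lambda>d. ereal (?sep d (?t d - c * real d))) \<le> 1"
        unfolding sep' by (intro Liminf_le eventually_mono[OF g_bounds[of "- c"]]) auto
    qed
  qed simp
  moreover have "(\<lambda>d. real d) \<in> o(?t)"
    by real_asymp
  ultimately show ?thesis
    using stationary ergodic unfolding separation_cutoff_def by auto
qed

end
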